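(* Let $(X,\mu,\mathcal{E},\mathcal{F})$ be a Dirichlet space with conservative heat semigroup $\{P_t\}_{t\in[0,\infty)}$. Assume that $P_t$ admits a measurable heat kernel $p_t(x,y)$ satisfying, for some $C>0$ and $\beta>0$, $p_t(x,y)\le C t^{-\beta}$ for $\mu\times\mu$-a.e. $(x,y)\in X\times X$ and each $t\in(0,+\infty)$. Let $0<\alpha<\beta$. Then for every $E\subset X$ with finite $\alpha$-perimeter, $$\mu(E)^{\frac{\beta-\alpha}{\beta}}\le C_{\mathrm{iso}}\,P_\alpha(E),\qquad\text{where}\qquad C_{\mathrm{iso}}=\frac{C^{\frac{\alpha}{\beta}}(\alpha+\beta)^{\frac{\alpha+\beta}{\beta}}}{2\beta\,\alpha^{\frac{\alpha}{\beta}}}$$ and $C$ is the constant in the heat kernel bound.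
   Context: $X$ is a good measurable space (the measure decomposition theorem holds and the $\sigma$-algebra is generated by a countable family; e.g. a Polish space) with a $\sigma$-finite measure $\mu$. A Dirichlet form is a densely defined closed symmetric form $(\mathcal{E},\mathcal{F})$ on $L^2(X,\mu)$ which is Markovian: if $u\in\mathcal F$ and $v$ satisfies $|v(x)-v(y)|\le|u(x)-u(y)|$ and $|v(x)|\le|u(x)|$ for a.e. $x,y$, then $v\in\mathcal F$ and $\mathcal E(v,v)\le\mathcal E(u,u)$. Then $(X,\mu,\mathcal E,\mathcal F)$ is called a Dirichlet space. $\{P_t\}_{t\ge0}$ is the associated self-adjoint sub-Markovian semigroup on $L^2(X,\mu)$ (the heat semigroup), extended to a contraction semigroup on every $L^p(X,\mu)$, $1\le p\le\infty$. It is conservative if $P_t1=1$ for all $t$. It admits a heat kernel if there is a measurable function $(t,x,y)\mapsto p_t(x,y)\ge0$ such that $P_tf(x)=\int_X p_t(x,y)f(y)\,d\mu(y)$ for all $t>0$ and $f\in L^p(X,\mu)$, $1\le p\le\infty$. For $f\in L^1(X,\mu)$, $$\|f\|_{1,\alpha}=\sup_{t>0}t^{-\alpha}\int_X\int_X|f(x)-f(y)|\,p_t(x,y)\,d\mu(x)\,d\mu(y),$$ and $\mathbf B^{1,\alpha}(X)=\{f\in L^1(X,\mu):\|f\|_{1,\alpha}<+\infty\}$. A measurable set $E\subset X$ of finite measure has finite $\alpha$-perimeter if $\mathbf 1_E\in\mathbf B^{1,\alpha}(X)$; in that case $P_\alpha(E):=\|\mathbf 1_E\|_{1,\alpha}$.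 *)

theory Defs
  imports "HOL-Probability.Probability"
begin

section \<open>Good measurable spaces\<close>

text \<open>
  The measure decomposition theorem for a measurable space: every probability measure \<open>Q\<close> on the
  product splits as \<open>Q(dx, dy) = k(x, dy) Q\<^sub>1(dx)\<close>, where \<open>Q\<^sub>1\<close> is the first marginal and \<open>k\<close> a
  probability kernel.
\<close>

definition measure_decomposition :: "'a measure \<Rightarrow> bool" where
  "measure_decomposition M \<longleftrightarrow>
     (\<forall>Q. sets Q = sets (M \<Otimes>\<^sub>M M) \<and> prob_space Q \<longrightarrow>
        (\<exists>k \<in> M \<rightarrow>\<^sub>M prob_algebra M. \<forall>A \<in> sets (M \<Otimes>\<^sub>M M).
           emeasure Q A = (\<integral>\<^sup>+ x. emeasure (k x) (Pair x -` A) \<partial>distr Q M fst)))"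

definition good_measurable_space :: "'a measure \<Rightarrow> bool" where
  "good_measurable_space M \<longleftrightarrow>
     measure_decomposition M \<and>
     (\<exists>G. countable G \<and> G \<subseteq> Pow (space M) \<and> sets M = sigma_sets (space M) G)"


section \<open>Lebesgue spaces\<close>

text \<open>
  Elements of \<open>L\<^sup>p\<close> are represented by measurable functions; all notions below that concern
  elements of \<open>L\<^sup>p\<close> are stated up to almost everywhere equality.
\<close>

definition eLp_norm :: "'a measure \<Rightarrow> ennreal \<Rightarrow> ('a \<Rightarrow> real) \<Rightarrow> ennreal" where
  "eLp_norm M p f =
     (if p = \<infinity> then esssup M (\<lambda>x. ennreal \<bar>f x\<bar>)
      else let q = enn2real p; I = (\<integral>\<^sup>+ x. ennreal (\<bar>f x\<bar> powr q) \<partial>M)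
           in if I = \<infinity> then \<infinity> else ennreal (enn2real I powr (1 / q)))"

definition Lp_space :: "'a measure \<Rightarrow> ennreal \<Rightarrow> ('a \<Rightarrow> real) set" where
  "Lp_space M p = {f \<in> borel_measurable M. eLp_norm M p f < \<infinity>}"

definition L2_inner :: "'a measure \<Rightarrow> ('a \<Rightarrow> real) \<Rightarrow> ('a \<Rightarrow> real) \<Rightarrow> real" where
  "L2_inner M f g = (\<integral>x. f x * g x \<partial>M)"


section \<open>Dirichlet spaces\<close>

type_synonym 'a form = "('a \<Rightarrow> real) \<Rightarrow> ('a \<Rightarrow> real) \<Rightarrow> real"

text \<open>
  A nonnegative symmetric bilinear form \<open>\<E>\<close> with domain a linear subspace \<open>\<F>\<close> of \<open>L\<^sup>2\<close>. The second
  clause says that \<open>\<F>\<close> and \<open>\<E>\<close> respect almost everywhere equality.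
\<close>

definition symmetric_form :: "'a measure \<Rightarrow> 'a form \<Rightarrow> ('a \<Rightarrow> real) set \<Rightarrow> bool" where
  "symmetric_form M \<E> \<F> \<longleftrightarrow>
     \<F> \<subseteq> Lp_space M 2 \<and>
     (\<forall>u \<in> \<F>. \<forall>v \<in> borel_measurable M. (AE x in M. u x = v x) \<longrightarrow>
        v \<in> \<F> \<and> (\<forall>w \<in> \<F>. \<E> v w = \<E> u w)) \<and>
     (\<lambda>_. 0) \<in> \<F> \<and>
     (\<forall>u \<in> \<F>. \<forall>v \<in> \<F>. \<forall>a b. (\<lambda>x. a * u x + b * v x) \<in> \<F> \<and>
        (\<forall>w \<in> \<F>. \<E> (\<lambda>x. a * u x + b * v x) w = a * \<E> u w + b * \<E> v w)) \<and>
     (\<forall>u \<in> \<F>. \<forall>v \<in> \<F>. \<E> u v = \<E> v u) \<and>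
     (\<forall>u \<in> \<F>. 0 \<le> \<E> u u)"

definition densely_defined :: "'a measure \<Rightarrow> ('a \<Rightarrow> real) set \<Rightarrow> bool" where
  "densely_defined M \<F> \<longleftrightarrow>
     (\<forall>f \<in> Lp_space M 2. \<forall>e>0. \<exists>u \<in> \<F>. eLp_norm M 2 (\<lambda>x. f x - u x) < ennreal e)"

definition energy :: "'a measure \<Rightarrow> 'a form \<Rightarrow> ('a \<Rightarrow> real) \<Rightarrow> real" where
  "energy M \<E> u = L2_inner M u u + \<E> u u"

text \<open>The form is closed if its domain is complete for the form norm.\<close>

definition closed_form :: "'a measure \<Rightarrow> 'a form \<Rightarrow> ('a \<Rightarrow> real) set \<Rightarrow> bool" where
  "closed_form M \<E> \<F> \<longleftrightarrow>
     (\<forall>u :: nat \<Rightarrow> 'a \<Rightarrow> real.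
        (\<forall>n. u n \<in> \<F>) \<and>
        (\<forall>e>0. \<exists>N. \<forall>m\<ge>N. \<forall>n\<ge>N. energy M \<E> (\<lambda>x. u m x - u n x) < e) \<longrightarrow>
        (\<exists>v \<in> \<F>. (\<lambda>n. energy M \<E> (\<lambda>x. u n x - v x)) \<longlonglongrightarrow> 0))"

definition markovian_form :: "'a measure \<Rightarrow> 'a form \<Rightarrow> ('a \<Rightarrow> real) set \<Rightarrow> bool" where
  "markovian_form M \<E> \<F> \<longleftrightarrow>
     (\<forall>u \<in> \<F>. \<forall>v \<in> borel_measurable M.
        (AE (x, y) in M \<Otimes>\<^sub>M M. \<bar>v x - v y\<bar> \<le> \<bar>u x - u y\<bar>) \<and>
        (AE x in M. \<bar>v x\<bar> \<le> \<bar>u x\<bar>) \<longrightarrow>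
        v \<in> \<F> \<and> \<E> v v \<le> \<E> u u)"

definition dirichlet_form :: "'a measure \<Rightarrow> 'a form \<Rightarrow> ('a \<Rightarrow> real) set \<Rightarrow> bool" where
  "dirichlet_form M \<E> \<F> \<longleftrightarrow>
     symmetric_form M \<E> \<F> \<and> densely_defined M \<F> \<and> closed_form M \<E> \<F> \<and> markovian_form M \<E> \<F>"

definition dirichlet_space :: "'a measure \<Rightarrow> 'a form \<Rightarrow> ('a \<Rightarrow> real) set \<Rightarrow> bool" where
  "dirichlet_space M \<E> \<F> \<longleftrightarrow>
     good_measurable_space M \<and> sigma_finite_measure M \<and> dirichlet_form M \<E> \<F>"


section \<open>The heat semigroup\<close>

type_synonym 'a semigroup = "real \<Rightarrow> ('a \<Rightarrow> real) \<Rightarrow> ('a \<Rightarrow> real)"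

definition contraction_semigroup :: "'a measure \<Rightarrow> ennreal \<Rightarrow> 'a semigroup \<Rightarrow> bool" where
  "contraction_semigroup M p P \<longleftrightarrow>
     (\<forall>t\<ge>0. \<forall>f \<in> Lp_space M p. P t f \<in> Lp_space M p \<and> eLp_norm M p (P t f) \<le> eLp_norm M p f) \<and>
     (\<forall>t\<ge>0. \<forall>f \<in> Lp_space M p. \<forall>g \<in> Lp_space M p. \<forall>a b.
        AE x in M. P t (\<lambda>y. a * f y + b * g y) x = a * P t f x + b * P t g x) \<and>
     (\<forall>f \<in> Lp_space M p. AE x in M. P 0 f x = f x) \<and>
     (\<forall>s\<ge>0. \<forall>t\<ge>0. \<forall>f \<in> Lp_space M p. AE x in M. P (s + t) f x = P s (P t f) x)"

text \<open>
  The generator of \<open>P\<close> on \<open>L\<^sup>2\<close>, as a relation between \<open>f\<close> and \<open>g\<close>: the difference quotients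
  \<open>(P\<^sub>t f - f) / t\<close> converge to \<open>g\<close> in \<open>L\<^sup>2\<close> as \<open>t\<close> tends to \<open>0\<close> from the right.
\<close>

definition L2_generator :: "'a measure \<Rightarrow> 'a semigroup \<Rightarrow> ('a \<Rightarrow> real) \<Rightarrow> ('a \<Rightarrow> real) \<Rightarrow> bool" where
  "L2_generator M P f g \<longleftrightarrow>
     f \<in> Lp_space M 2 \<and> g \<in> Lp_space M 2 \<and>
     ((\<lambda>t. eLp_norm M 2 (\<lambda>x. (P t f x - f x) / t - g x)) \<longlongrightarrow> 0) (at_right 0)"

text \<open>The nonpositive self-adjoint operator \<open>L\<close> with \<open>\<E>(f, v) = - \<langle>L f, v\<rangle>\<close> for all \<open>v \<in> \<F>\<close>.\<close>

definition form_operator ::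
  "'a measure \<Rightarrow> 'a form \<Rightarrow> ('a \<Rightarrow> real) set \<Rightarrow> ('a \<Rightarrow> real) \<Rightarrow> ('a \<Rightarrow> real) \<Rightarrow> bool" where
  "form_operator M \<E> \<F> f g \<longleftrightarrow>
     f \<in> \<F> \<and> g \<in> Lp_space M 2 \<and> (\<forall>v \<in> \<F>. \<E> f v = - L2_inner M g v)"

text \<open>
  The semigroup on \<open>L\<^sup>2\<close> associated with \<open>(\<E>, \<F>)\<close>: the strongly continuous semigroup of
  self-adjoint contractions whose generator is the operator of the form.
\<close>

definition associated_semigroup ::
  "'a measure \<Rightarrow> 'a form \<Rightarrow> ('a \<Rightarrow> real) set \<Rightarrow> 'a semigroup \<Rightarrow> bool" where
  "associated_semigroup M \<E> \<F> P \<longleftrightarrow>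
     contraction_semigroup M 2 P \<and>
     (\<forall>t\<ge>0. \<forall>f \<in> Lp_space M 2. \<forall>g \<in> Lp_space M 2. L2_inner M (P t f) g = L2_inner M f (P t g)) \<and>
     (\<forall>f \<in> Lp_space M 2. ((\<lambda>t. eLp_norm M 2 (\<lambda>x. P t f x - f x)) \<longlongrightarrow> 0) (at_right 0)) \<and>
     (\<forall>f g. L2_generator M P f g \<longleftrightarrow> form_operator M \<E> \<F> f g)"

text \<open>
  \<open>P\<close> is the extension of its own restriction to \<open>L\<^sup>2\<close> to all \<open>L\<^sup>p\<close>. Contractivity and linearity
  determine the extension only for \<open>p < \<infinity>\<close>, where \<open>L\<^sup>2 \<inter> L\<^sup>p\<close> is dense; the second clause fixes it for
  \<open>p = \<infinity>\<close> as well, since every nonnegative function on a \<open>\<sigma>\<close>-finite space is an increasing limit of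
  nonnegative functions in \<open>L\<^sup>2\<close>.
\<close>

definition Lp_extended_semigroup :: "'a measure \<Rightarrow> 'a semigroup \<Rightarrow> bool" where
  "Lp_extended_semigroup M P \<longleftrightarrow>
     (\<forall>p. 1 \<le> p \<longrightarrow> contraction_semigroup M p P) \<and>
     (\<forall>p. 1 \<le> p \<longrightarrow> (\<forall>t\<ge>0. \<forall>f \<in> Lp_space M p. \<forall>u :: nat \<Rightarrow> 'a \<Rightarrow> real.
        (\<forall>n. u n \<in> Lp_space M 2) \<and>
        (AE x in M. (\<forall>n. 0 \<le> u n x \<and> u n x \<le> u (Suc n) x) \<and> (\<lambda>n. u n x) \<longlonglongrightarrow> f x) \<longrightarrow>
        (AE x in M. (\<lambda>n. P t (u n) x) \<longlonglongrightarrow> P t f x)))"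

definition heat_semigroup ::
  "'a measure \<Rightarrow> 'a form \<Rightarrow> ('a \<Rightarrow> real) set \<Rightarrow> 'a semigroup \<Rightarrow> bool" where
  "heat_semigroup M \<E> \<F> P \<longleftrightarrow> associated_semigroup M \<E> \<F> P \<and> Lp_extended_semigroup M P"

definition conservative :: "'a measure \<Rightarrow> 'a semigroup \<Rightarrow> bool" where
  "conservative M P \<longleftrightarrow> (\<forall>t\<ge>0. AE x in M. P t (\<lambda>_. 1) x = 1)"

definition heat_kernel :: "'a measure \<Rightarrow> 'a semigroup \<Rightarrow> (real \<Rightarrow> 'a \<Rightarrow> 'a \<Rightarrow> real) \<Rightarrow> bool" where
  "heat_kernel M P p \<longleftrightarrow>
     (\<lambda>(t, x, y). p t x y) \<in> borel_measurable (restrict_space borel {0<..} \<Otimes>\<^sub>M M \<Otimes>\<^sub>M M) \<and>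
     (\<forall>t>0. \<forall>x \<in> space M. \<forall>y \<in> space M. 0 \<le> p t x y) \<and>
     (\<forall>t>0. \<forall>q\<ge>1. \<forall>f \<in> Lp_space M q.
        AE x in M. integrable M (\<lambda>y. p t x y * f y) \<and> P t f x = (\<integral>y. p t x y * f y \<partial>M))"


section \<open>Besov spaces and perimeter\<close>

definition besov_seminorm ::
  "'a measure \<Rightarrow> (real \<Rightarrow> 'a \<Rightarrow> 'a \<Rightarrow> real) \<Rightarrow> real \<Rightarrow> ('a \<Rightarrow> real) \<Rightarrow> ennreal" where
  "besov_seminorm M p \<alpha> f =
     (SUP t \<in> {0<..}. ennreal (t powr (- \<alpha>)) *
        (\<integral>\<^sup>+ y. (\<integral>\<^sup>+ x. ennreal (\<bar>f x - f y\<bar> * p t x y) \<partial>M) \<partial>M))"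

definition besov_space ::
  "'a measure \<Rightarrow> (real \<Rightarrow> 'a \<Rightarrow> 'a \<Rightarrow> real) \<Rightarrow> real \<Rightarrow> ('a \<Rightarrow> real) set" where
  "besov_space M p \<alpha> = {f \<in> Lp_space M 1. besov_seminorm M p \<alpha> f < \<infinity>}"

definition finite_perimeter ::
  "'a measure \<Rightarrow> (real \<Rightarrow> 'a \<Rightarrow> 'a \<Rightarrow> real) \<Rightarrow> real \<Rightarrow> 'a set \<Rightarrow> bool" where
  "finite_perimeter M p \<alpha> E \<longleftrightarrow>
     E \<in> sets M \<and> emeasure M E < \<infinity> \<and> indicat_real E \<in> besov_space M p \<alpha>"

definition perimeter ::
  "'a measure \<Rightarrow> (real \<Rightarrow> 'a \<Rightarrow> 'a \<Rightarrow> real) \<Rightarrow> real \<Rightarrow> 'a set \<Rightarrow> ennreal" where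
  "perimeter M p \<alpha> E = besov_seminorm M p \<alpha> (indicat_real E)"

definition isoperimetric_constant :: "real \<Rightarrow> real \<Rightarrow> real \<Rightarrow> real" where
  "isoperimetric_constant C \<alpha> \<beta> =
     C powr (\<alpha> / \<beta>) * (\<alpha> + \<beta>) powr ((\<alpha> + \<beta>) / \<beta>) / (2 * \<beta> * \<alpha> powr (\<alpha> / \<beta>))"

end

theory Submission
  imports Defs
begin

text \<open>
  For every \<open>t > 0\<close>, symmetry of the kernel and conservativeness show that the double integral in
  \<open>P\<^sub>\<alpha>(E)\<close> is twice \<open>\<mu>(E) - \<langle>P\<^sub>t 1\<^sub>E, 1\<^sub>E\<rangle>\<close>, which is at least \<open>2 (\<mu>(E) - C t\<^sup>-\<^sup>\<beta> \<mu>(E)\<^sup>2)\<close>.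
  Multiplying by \<open>t\<^sup>-\<^sup>\<alpha>\<close>, the lower bound is maximal at \<open>t\<^sup>-\<^sup>\<beta> = \<alpha> / (C (\<alpha> + \<beta>) \<mu>(E))\<close>, where it equals
  \<open>\<mu>(E)\<close> to the power \<open>(\<beta> - \<alpha>) / \<beta>\<close>, divided by the isoperimetric constant.
\<close>

section \<open>Integrals of the heat kernel against indicators and constants\<close>

lemma bounded_in_Lp_top:
  assumes "f \<in> borel_measurable M" "\<And>x. \<bar>f x\<bar> \<le> c"
  shows "f \<in> Lp_space M \<infinity>"
proof -
  have "esssup M (\<lambda>x. ennreal \<bar>f x\<bar>) \<le> ennreal c"
    by (rule esssup_I) (use assms in \<open>auto intro!: ennreal_leI\<close>)
  also have "\<dots> < \<infinity>"
    by simp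
  finally show ?thesis
    using assms by (simp add: Lp_space_def eLp_norm_def)
qed

lemma indicator_in_L2:
  assumes "A \<in> sets M" "emeasure M A < \<infinity>"
  shows "indicat_real A \<in> Lp_space M 2"
proof -
  have "(\<integral>\<^sup>+ x. ennreal (\<bar>indicat_real A x\<bar> powr enn2real 2) \<partial>M) = (\<integral>\<^sup>+ x. indicator A x \<partial>M)"
    by (intro nn_integral_cong) (auto simp: indicator_def)
  then show ?thesis
    using assms by (simp add: Lp_space_def eLp_norm_def Let_def)
qed

lemma heat_kernel_measurable:
  assumes "heat_kernel M P p" "t > 0"
  shows "(\<lambda>(x, y). p t x y) \<in> borel_measurable (M \<Otimes>\<^sub>M M)"
proof -
  have "(\<lambda>(t, x, y). p t x y) \<in> borel_measurable (restrict_space borel {0<..} \<Otimes>\<^sub>M M \<Otimes>\<^sub>M M)"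
    using assms by (simp add: heat_kernel_def)
  moreover have "(\<lambda>z. (t, z)) \<in> M \<Otimes>\<^sub>M M \<rightarrow>\<^sub>M restrict_space borel {0<..} \<Otimes>\<^sub>M M \<Otimes>\<^sub>M M"
    using assms by (intro measurable_Pair1') (simp add: space_restrict_space)
  ultimately have "(\<lambda>z. case (t, z) of (t, x, y) \<Rightarrow> p t x y) \<in> borel_measurable (M \<Otimes>\<^sub>M M)"
    by (rule measurable_compose_rev)
  then show ?thesis
    by (simp add: case_prod_beta)
qed

lemma heat_kernel_nonneg:
  assumes "heat_kernel M P p" "t > 0" "x \<in> space M" "y \<in> space M"
  shows "0 \<le> p t x y"
  using assms by (simp add: heat_kernel_def)


text \<open>Passing from Bochner to nonnegative integrals makes Tonelli and monotonicity available
  without further integrability checks. The sign of \<open>P t f\<close> is recorded because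
  \<open>ennreal\<close> would send negative values to 0.\<close>

lemma heat_kernel_nn_integral:
  assumes "heat_kernel M P p" "t > 0" "1 \<le> q" "f \<in> Lp_space M q" "\<And>x. 0 \<le> f x"
  shows "AE x in M. (\<integral>\<^sup>+ y. ennreal (p t x y * f y) \<partial>M) = ennreal (P t f x) \<and> 0 \<le> P t f x"
proof -
  have "AE x in M. integrable M (\<lambda>y. p t x y * f y) \<and> P t f x = (\<integral>y. p t x y * f y \<partial>M)"
    using assms by (simp add: heat_kernel_def)
  with AE_space show ?thesis
  proof eventually_elim
    case (elim x)
    have "AE y in M. 0 \<le> p t x y * f y"
      using heat_kernel_nonneg[OF assms(1,2)] elim(1) assms(5) by (auto intro!: AE_I2)
    then show ?case
      using elim(2) by (simp add: nn_integral_eq_integral integral_nonneg_AE)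
  qed
qed

lemma heat_kernel_set_nn_integral:
  assumes "heat_kernel M P p" "t > 0" "A \<in> sets M"
  shows "AE x in M. (\<integral>\<^sup>+ y\<in>A. ennreal (p t x y) \<partial>M) = ennreal (P t (indicat_real A) x)
           \<and> 0 \<le> P t (indicat_real A) x"
proof -
  have "indicat_real A \<in> Lp_space M \<infinity>"
    by (rule bounded_in_Lp_top[where c = 1]) (use assms in \<open>auto simp: indicator_def\<close>)
  then have "AE x in M. (\<integral>\<^sup>+ y. ennreal (p t x y * indicat_real A y) \<partial>M) = ennreal (P t (indicat_real A) x)
           \<and> 0 \<le> P t (indicat_real A) x"
    by (intro heat_kernel_nn_integral[OF assms(1,2), where q = \<infinity>]) auto
  moreover have "ennreal (p t x y * indicat_real A y) = ennreal (p t x y) * indicator A y" for x y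
    by (simp add: indicator_def)
  ultimately show ?thesis
    by simp
qed

text \<open>Conservativeness as seen by the kernel: the constant 1 lies in L^\<infinity> whatever
  the measure of the space, so the kernel formula applies to it with
  \<open>q = \<infinity>\<close>.\<close>

lemma heat_kernel_total_mass:
  assumes "heat_kernel M P p" "conservative M P" "t > 0"
  shows "AE x in M. (\<integral>\<^sup>+ y. ennreal (p t x y) \<partial>M) = 1"
proof -
  have "(\<lambda>_. 1) \<in> Lp_space M \<infinity>"
    by (rule bounded_in_Lp_top[where c = 1]) auto
  then have "AE x in M. (\<integral>\<^sup>+ y. ennreal (p t x y * 1) \<partial>M) = ennreal (P t (\<lambda>_. 1) x)
           \<and> 0 \<le> P t (\<lambda>_. 1) x"
    by (intro heat_kernel_nn_integral[OF assms(1,3), where q = \<infinity>]) auto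
  moreover have "AE x in M. P t (\<lambda>_. 1) x = 1"
    using assms by (simp add: conservative_def)
  ultimately show ?thesis
    by eventually_elim simp
qed

section \<open>Symmetry of the heat flow between two sets\<close>

text \<open>Links the kernel to the L^2 pairing, the only place where self-adjointness of the
  semigroup is expressed.\<close>

lemma heat_kernel_L2_inner:
  assumes "associated_semigroup M \<E> \<F> P" "heat_kernel M P p" "conservative M P" "t > 0"
    and "A \<in> sets M" "emeasure M A < \<infinity>" "B \<in> sets M" "emeasure M B < \<infinity>"
  shows "(\<integral>\<^sup>+ x\<in>B. (\<integral>\<^sup>+ y\<in>A. ennreal (p t x y) \<partial>M) \<partial>M)
           = ennreal (L2_inner M (P t (indicat_real A)) (indicat_real B))"
proof -
  let ?u = "P t (indicat_real A)"
  have "?u \<in> Lp_space M 2"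
    using assms indicator_in_L2[of A M] by (simp add: associated_semigroup_def contraction_semigroup_def)
  then have [measurable]: "?u \<in> borel_measurable M"
    by (simp add: Lp_space_def)
  note u = heat_kernel_set_nn_integral[OF assms(2,4,5)]
  have bound: "AE x in M. ?u x \<le> 1"
    using u heat_kernel_total_mass[OF assms(2-4)]
  proof eventually_elim
    case (elim x)
    have "(\<integral>\<^sup>+ y\<in>A. ennreal (p t x y) \<partial>M) \<le> (\<integral>\<^sup>+ y. ennreal (p t x y) \<partial>M)"
      by (intro nn_integral_mono) (simp add: indicator_def)
    then show ?case
      using elim by simp
  qed
  \<comment> \<open>A non-integrable function would have Bochner integral 0, so integrability must
    come first. It follows from 0 \<le> \<open>?u\<close> \<le> 1 almost everywhere and the finite
    measure of \<open>B\<close>.\<close>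
  have "integrable M (\<lambda>x. ?u x * indicat_real B x)"
  proof (rule Bochner_Integration.integrable_bound)
    show "integrable M (indicat_real B)"
      using assms by simp
    show "AE x in M. norm (?u x * indicat_real B x) \<le> norm (indicat_real B x)"
      using u bound by eventually_elim (auto simp: indicator_def)
  qed (use assms in measurable)
  moreover have "AE x in M. 0 \<le> ?u x * indicat_real B x"
    using u by eventually_elim (auto simp: indicator_def)
  ultimately have "ennreal (L2_inner M ?u (indicat_real B)) = (\<integral>\<^sup>+ x. ennreal (?u x * indicat_real B x) \<partial>M)"
    by (simp add: nn_integral_eq_integral L2_inner_def)
  also have "\<dots> = (\<integral>\<^sup>+ x\<in>B. (\<integral>\<^sup>+ y\<in>A. ennreal (p t x y) \<partial>M) \<partial>M)"
    by (rule nn_integral_cong_AE) (use u in eventually_elim, auto simp: indicator_def)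
  finally show ?thesis
    by simp
qed

text \<open>Pointwise symmetry of \<open>p t\<close> is not part of \<open>heat_kernel\<close>.
  Self-adjointness of \<open>P t\<close> supplies an integrated form of it, for sets whose
  indicators lie in L^2.\<close>

lemma heat_kernel_symmetric_finite:
  assumes "associated_semigroup M \<E> \<F> P" "heat_kernel M P p" "conservative M P" "t > 0"
    and "A \<in> sets M" "emeasure M A < \<infinity>" "B \<in> sets M" "emeasure M B < \<infinity>"
  shows "(\<integral>\<^sup>+ x\<in>B. (\<integral>\<^sup>+ y\<in>A. ennreal (p t x y) \<partial>M) \<partial>M)
           = (\<integral>\<^sup>+ x\<in>A. (\<integral>\<^sup>+ y\<in>B. ennreal (p t x y) \<partial>M) \<partial>M)"
proof -
  have "L2_inner M (P t (indicat_real A)) (indicat_real B) = L2_inner M (indicat_real A) (P t (indicat_real B))"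
    using assms indicator_in_L2[of A M] indicator_in_L2[of B M] by (simp add: associated_semigroup_def)
  then show ?thesis
    using heat_kernel_L2_inner[OF assms] heat_kernel_L2_inner[OF assms(1-4,7,8,5,6)]
    by (simp add: L2_inner_def mult.commute)
qed

text \<open>Removes the finiteness condition on one of the two sets, since the complement of
  \<open>E\<close> may have infinite measure. For fixed \<open>A\<close>, both sides are measures in
  \<open>B\<close> that agree on sets of finite measure, and continuity from below along an
  exhaustion extends the equality.\<close>

lemma heat_kernel_flux_symmetric:
  assumes "sigma_finite_measure M" "associated_semigroup M \<E> \<F> P" "heat_kernel M P p"
    and "conservative M P" "t > 0"
    and A: "A \<in> sets M" "emeasure M A < \<infinity>" and B[measurable]: "B \<in> sets M"
  shows "(\<integral>\<^sup>+ x\<in>B. (\<integral>\<^sup>+ y\<in>A. ennreal (p t x y) \<partial>M) \<partial>M)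
           = (\<integral>\<^sup>+ x\<in>A. (\<integral>\<^sup>+ y\<in>B. ennreal (p t x y) \<partial>M) \<partial>M)"
proof -
  interpret sigma_finite_measure M by fact
  interpret pair_sigma_finite M M ..
  note A(1)[measurable]
  have [measurable]: "(\<lambda>(x, y). p t x y) \<in> borel_measurable (M \<Otimes>\<^sub>M M)"
    using heat_kernel_measurable assms by blast
  \<comment> \<open>The densities of the two measures: \<open>g\<close> integrates out the second
    variable of the kernel over \<open>A\<close>, \<open>h\<close> the first. The right-hand side
    becomes the integral of \<open>h\<close> over \<open>B\<close> only after Tonelli
    (\<open>swap\<close>).\<close>
  define g where "g x = (\<integral>\<^sup>+ y\<in>A. ennreal (p t x y) \<partial>M)" for x
  define h where "h y = (\<integral>\<^sup>+ x\<in>A. ennreal (p t x y) \<partial>M)" for y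
  have [measurable]: "g \<in> borel_measurable M" "h \<in> borel_measurable M"
    unfolding g_def h_def by measurable
  have swap: "(\<integral>\<^sup>+ x\<in>A. (\<integral>\<^sup>+ y\<in>S. ennreal (p t x y) \<partial>M) \<partial>M) = (\<integral>\<^sup>+ y\<in>S. h y \<partial>M)"
    if [measurable]: "S \<in> sets M" for S
  proof -
    have "(\<integral>\<^sup>+ x\<in>A. (\<integral>\<^sup>+ y\<in>S. ennreal (p t x y) \<partial>M) \<partial>M)
        = (\<integral>\<^sup>+ x. (\<integral>\<^sup>+ y. ennreal (p t x y) * indicator S y * indicator A x \<partial>M) \<partial>M)"
      by (simp add: nn_integral_multc cong: nn_integral_cong)
    also have "\<dots> = (\<integral>\<^sup>+ y. (\<integral>\<^sup>+ x. ennreal (p t x y) * indicator S y * indicator A x \<partial>M) \<partial>M)"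
      by (rule Fubini'[symmetric]) measurable
    also have "\<dots> = (\<integral>\<^sup>+ y\<in>S. h y \<partial>M)"
      by (simp add: h_def nn_integral_multc[symmetric] mult.assoc mult.commute[of "indicator S _"]
            cong: nn_integral_cong)
    finally show ?thesis .
  qed
  obtain X :: "nat \<Rightarrow> 'a set" where X: "range X \<subseteq> sets M" "(\<Union>i. X i) = space M"
    "\<And>i. emeasure M (X i) \<noteq> \<infinity>" "incseq X"
    using sigma_finite_measure.sigma_finite_incseq[OF assms(1)] by metis
  have X_sets: "X i \<in> sets M" for i
    using X by blast
  have sup: "emeasure (density M f) B = (SUP i. emeasure (density M f) (B \<inter> X i))"
    if [measurable]: "f \<in> borel_measurable M" for f
  proof -
    have "(\<Union>i. B \<inter> X i) = B"
      using X(2) sets.sets_into_space[OF B] by auto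
    then show ?thesis
      by (subst SUP_emeasure_incseq)
        (use X(4) X_sets in \<open>auto simp: incseq_def\<close>)
  qed
  have "emeasure (density M g) (B \<inter> X i) = emeasure (density M h) (B \<inter> X i)" for i
  proof -
    have S: "B \<inter> X i \<in> sets M"
      using X_sets by simp
    have "emeasure M (B \<inter> X i) \<le> emeasure M (X i)"
      using X_sets by (intro emeasure_mono) auto
    then have fin: "emeasure M (B \<inter> X i) < \<infinity>"
      using X(3)[of i] by (auto simp: less_top[symmetric] top_unique)
    show ?thesis
      using heat_kernel_symmetric_finite[OF assms(2-5) A S fin] S
      by (simp add: emeasure_density swap g_def[symmetric])
  qed
  then have "emeasure (density M g) B = emeasure (density M h) B"
    by (simp add: sup)
  then show ?thesis
    by (simp add: emeasure_density swap g_def[symmetric])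
qed

section \<open>Lower bounds for the flux out of a set and for its perimeter\<close>

text \<open>From almost every \<open>x\<close>, the kernel carries total mass 1, of which at most
  \<open>K\<close> times the measure of \<open>E\<close> lands in \<open>E\<close>; the rest must
  land in the complement. Integrating over \<open>x\<close> in \<open>E\<close> gives the
  bound.\<close>

lemma heat_kernel_flux_lower_bound:
  assumes "sigma_finite_measure M" "heat_kernel M P p" "conservative M P" "t > 0"
    and bound: "AE (x, y) in M \<Otimes>\<^sub>M M. p t x y \<le> K" "0 \<le> K"
    and E: "E \<in> sets M" "emeasure M E < \<infinity>"
  shows "ennreal (measure M E - K * (measure M E)\<^sup>2)
           \<le> (\<integral>\<^sup>+ x\<in>E. (\<integral>\<^sup>+ y\<in>space M - E. ennreal (p t x y) \<partial>M) \<partial>M)" (is "_ \<le> ?F")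
proof -
  interpret sigma_finite_measure M by fact
  interpret pair_sigma_finite M M ..
  note E(1)[measurable]
  have [measurable]: "(\<lambda>(x, y). p t x y) \<in> borel_measurable (M \<Otimes>\<^sub>M M)"
    using heat_kernel_measurable assms by blast
  let ?m = "measure M E"
  have m: "emeasure M E = ennreal ?m"
    using E by (simp add: emeasure_eq_ennreal_measure less_top)
  have "AE x in M. AE y in M. p t x y \<le> K"
    using AE_pair[OF bound(1)] by simp
  then have "AE x in M. (\<integral>\<^sup>+ y\<in>E. ennreal (p t x y) \<partial>M) \<le> ennreal K * emeasure M E"
  proof eventually_elim
    case (elim x)
    have "(\<integral>\<^sup>+ y\<in>E. ennreal (p t x y) \<partial>M) \<le> (\<integral>\<^sup>+ y\<in>E. ennreal K \<partial>M)"
      by (rule nn_integral_mono_AE) (use elim in eventually_elim, auto simp: indicator_def intro: ennreal_leI)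
    then show ?case
      by (simp add: nn_integral_cmult)
  qed
  with heat_kernel_total_mass[OF assms(2-4)] AE_space
  have "AE x in M. 1 \<le> ennreal K * emeasure M E + (\<integral>\<^sup>+ y\<in>space M - E. ennreal (p t x y) \<partial>M)"
  proof eventually_elim
    case (elim x)
    note elim(2)[measurable]
    have "1 = (\<integral>\<^sup>+ y. ennreal (p t x y) * indicator E y + ennreal (p t x y) * indicator (space M - E) y \<partial>M)"
      unfolding elim(1)[symmetric] by (intro nn_integral_cong) (auto simp: indicator_def)
    also have "\<dots> = (\<integral>\<^sup>+ y\<in>E. ennreal (p t x y) \<partial>M) + (\<integral>\<^sup>+ y\<in>space M - E. ennreal (p t x y) \<partial>M)"
      by (rule nn_integral_add) measurable
    finally show ?case
      using elim(3) by (metis add_right_mono)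
  qed
  then have "(\<integral>\<^sup>+ x\<in>E. 1 \<partial>M)
      \<le> (\<integral>\<^sup>+ x\<in>E. (ennreal K * emeasure M E + (\<integral>\<^sup>+ y\<in>space M - E. ennreal (p t x y) \<partial>M)) \<partial>M)"
    by (intro nn_integral_mono_AE) (auto simp: indicator_def)
  also have "\<dots> = (\<integral>\<^sup>+ x\<in>E. ennreal K * emeasure M E \<partial>M) + ?F"
    unfolding distrib_right by (rule nn_integral_add) measurable
  also have "(\<integral>\<^sup>+ x\<in>E. ennreal K * emeasure M E \<partial>M) = ennreal K * emeasure M E * emeasure M E"
    by (rule nn_integral_cmult_indicator) fact
  finally have "ennreal ?m \<le> ennreal (K * ?m\<^sup>2) + ?F"
    using bound(2) by (simp add: m ennreal_mult'[symmetric] power2_eq_square mult.assoc)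
  then show ?thesis
    \<comment> \<open>Subtraction in \<open>ennreal\<close> truncates at 0, as does
      \<open>ennreal\<close> of a negative real, so no case split on the sign of the left-hand side
      is needed.\<close>
    using bound(2) by (simp add: ennreal_minus[symmetric] ennreal_minus_le_iff)
qed

text \<open>The difference of indicators is nonzero only when exactly one of \<open>x\<close> and
  \<open>y\<close> lies in \<open>E\<close>. The double integral thus splits into the fluxes out of
  and into \<open>E\<close>, which are equal by symmetry; the seminorm dominates its value at each
  single \<open>t\<close>.\<close>

lemma besov_seminorm_indicator_ge:
  assumes "sigma_finite_measure M" "associated_semigroup M \<E> \<F> P" "heat_kernel M P p"
    and "conservative M P" "t > 0"
    and bound: "AE (x, y) in M \<Otimes>\<^sub>M M. p t x y \<le> K" "0 \<le> K"
    and E: "E \<in> sets M" "emeasure M E < \<infinity>"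
  shows "ennreal (t powr (- \<alpha>) * (2 * (measure M E - K * (measure M E)\<^sup>2)))
           \<le> besov_seminorm M p \<alpha> (indicat_real E)"
proof -
  interpret sigma_finite_measure M by fact
  interpret pair_sigma_finite M M ..
  note E(1)[measurable]
  have [measurable]: "(\<lambda>(x, y). p t x y) \<in> borel_measurable (M \<Otimes>\<^sub>M M)"
    using heat_kernel_measurable assms by blast
  let ?F = "\<lambda>A B. (\<integral>\<^sup>+ x\<in>A. (\<integral>\<^sup>+ y\<in>B. ennreal (p t x y) \<partial>M) \<partial>M)"
  let ?D = "space M - E"
  \<comment> \<open>The seminorm integrates over \<open>x\<close> first, the fluxes over
    \<open>y\<close> first.\<close>
  have "(\<integral>\<^sup>+ y. (\<integral>\<^sup>+ x. ennreal (\<bar>indicat_real E x - indicat_real E y\<bar> * p t x y) \<partial>M) \<partial>M)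
      = (\<integral>\<^sup>+ x. (\<integral>\<^sup>+ y. ennreal (\<bar>indicat_real E x - indicat_real E y\<bar> * p t x y) \<partial>M) \<partial>M)"
    by (rule Fubini') measurable
  also have "\<dots> = (\<integral>\<^sup>+ x. (\<integral>\<^sup>+ y\<in>?D. ennreal (p t x y) \<partial>M) * indicator E x
      + (\<integral>\<^sup>+ y\<in>E. ennreal (p t x y) \<partial>M) * indicator ?D x \<partial>M)"
  proof (rule nn_integral_cong)
    fix x assume "x \<in> space M"
    then show "(\<integral>\<^sup>+ y. ennreal (\<bar>indicat_real E x - indicat_real E y\<bar> * p t x y) \<partial>M)
      = (\<integral>\<^sup>+ y\<in>?D. ennreal (p t x y) \<partial>M) * indicator E x
      + (\<integral>\<^sup>+ y\<in>E. ennreal (p t x y) \<partial>M) * indicator ?D x"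
      by (cases "x \<in> E") (auto intro!: nn_integral_cong simp: indicator_def)
  qed
  also have "\<dots> = ?F E ?D + ?F ?D E"
    by (rule nn_integral_add) measurable
  also have "?F ?D E = ?F E ?D"
    by (rule heat_kernel_flux_symmetric[OF assms(1-5) E]) simp
  finally have *: "(\<integral>\<^sup>+ y. (\<integral>\<^sup>+ x. ennreal (\<bar>indicat_real E x - indicat_real E y\<bar> * p t x y) \<partial>M) \<partial>M)
      = 2 * ?F E ?D"
    by (simp add: mult_2)
  have "ennreal (2 * (measure M E - K * (measure M E)\<^sup>2)) \<le> 2 * ?F E ?D"
    using mult_left_mono[OF heat_kernel_flux_lower_bound[OF assms(1,3-9)], of 2]
    by (simp only: ennreal_mult' ennreal_numeral zero_le_numeral)
  then have "ennreal (t powr (- \<alpha>) * (2 * (measure M E - K * (measure M E)\<^sup>2)))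
      \<le> ennreal (t powr (- \<alpha>)) * (2 * ?F E ?D)"
    unfolding ennreal_mult'[OF powr_ge_zero] by (rule mult_left_mono) simp
  also have "\<dots> \<le> besov_seminorm M p \<alpha> (indicat_real E)"
    unfolding besov_seminorm_def *[symmetric] by (rule SUP_upper) (use assms in simp)
  finally show ?thesis .
qed

section \<open>The optimal time and the isoperimetric inequality\<close>

text \<open>The chosen \<open>t\<close> is the critical point of \<open>t powr (- \<alpha>) * (m - C
  * t powr (- \<beta>) * m\<^sup>2)\<close>: a vanishing derivative means
  \<open>\<alpha> = (\<alpha> + \<beta>) * C * m * t powr (- \<beta>)\<close>. The identity itself
  only requires evaluating at this \<open>t\<close>, where the bracket equals
  \<open>m * \<beta> / (\<alpha> + \<beta>)\<close>.\<close>

lemma isoperimetric_constant_optimal: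
  fixes C \<alpha> \<beta> m :: real
  assumes "C > 0" "\<alpha> > 0" "\<beta> > 0" "m > 0"
  defines "t \<equiv> (C * m * (\<alpha> + \<beta>) / \<alpha>) powr (1 / \<beta>)"
  shows "m powr ((\<beta> - \<alpha>) / \<beta>)
           = isoperimetric_constant C \<alpha> \<beta> * (t powr (- \<alpha>) * (2 * (m - C * t powr (- \<beta>) * m\<^sup>2)))"
proof -
  have *: "t powr (- \<beta>) = \<alpha> / (C * m * (\<alpha> + \<beta>))"
    using assms by (simp add: t_def powr_powr powr_minus)
  have "C * t powr (- \<beta>) * m\<^sup>2 = m * \<alpha> / (\<alpha> + \<beta>)"
    unfolding * using assms by (simp add: power2_eq_square)
  then have "m - C * t powr (- \<beta>) * m\<^sup>2 = m * \<beta> / (\<alpha> + \<beta>)"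
    using assms by (simp add: field_simps)
  moreover have "t powr (- \<alpha>) = \<alpha> powr (\<alpha> / \<beta>) / (C powr (\<alpha> / \<beta>) * m powr (\<alpha> / \<beta>) * (\<alpha> + \<beta>) powr (\<alpha> / \<beta>))"
    using assms by (simp add: t_def powr_powr powr_minus powr_mult powr_divide)
  moreover have "m powr ((\<beta> - \<alpha>) / \<beta>) = m / m powr (\<alpha> / \<beta>)"
    using assms by (simp add: diff_divide_distrib powr_diff)
  moreover have "(\<alpha> + \<beta>) powr ((\<alpha> + \<beta>) / \<beta>) = (\<alpha> + \<beta>) powr (\<alpha> / \<beta>) * (\<alpha> + \<beta>)"
    using assms by (simp add: add_divide_distrib powr_add)
  ultimately show ?thesis
    using assms by (simp add: isoperimetric_constant_def)
qed

theorem proposition6p5: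
  fixes M :: "'a measure"
    and \<E> :: "('a \<Rightarrow> real) \<Rightarrow> ('a \<Rightarrow> real) \<Rightarrow> real"
    and \<F> :: "('a \<Rightarrow> real) set"
    and P :: "real \<Rightarrow> ('a \<Rightarrow> real) \<Rightarrow> ('a \<Rightarrow> real)"
    and p :: "real \<Rightarrow> 'a \<Rightarrow> 'a \<Rightarrow> real"
    and C \<alpha> \<beta> :: real
  assumes "dirichlet_space M \<E> \<F>"
    and "heat_semigroup M \<E> \<F> P"
    and "conservative M P"
    and "heat_kernel M P p"
    and "C > 0" and "\<beta> > 0"
    and "\<And>t. t > 0 \<Longrightarrow> AE (x, y) in M \<Otimes>\<^sub>M M. p t x y \<le> C * t powr (- \<beta>)"
    and "0 < \<alpha>" and "\<alpha> < \<beta>"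
  shows "\<forall>E. finite_perimeter M p \<alpha> E \<longrightarrow>
    ennreal (measure M E powr ((\<beta> - \<alpha>) / \<beta>)) \<le>
      ennreal (isoperimetric_constant C \<alpha> \<beta>) * perimeter M p \<alpha> E"
proof (intro allI impI)
  fix E assume "finite_perimeter M p \<alpha> E"
  then have E: "E \<in> sets M" "emeasure M E < \<infinity>"
    by (auto simp: finite_perimeter_def)
  have nonneg: "0 \<le> isoperimetric_constant C \<alpha> \<beta>"
    using assms by (simp add: isoperimetric_constant_def)
  show "ennreal (measure M E powr ((\<beta> - \<alpha>) / \<beta>))
    \<le> ennreal (isoperimetric_constant C \<alpha> \<beta>) * perimeter M p \<alpha> E"
  \<comment> \<open>For a null set the optimal time would degenerate to 0; the claim is then trivial
    because \<open>0 powr a = 0\<close>.\<close>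
  proof (cases "measure M E = 0")
    case False
    then have pos: "measure M E > 0"
      by (simp add: zero_less_measure_iff)
    define t where "t = (C * measure M E * (\<alpha> + \<beta>) / \<alpha>) powr (1 / \<beta>)"
    have t: "t > 0"
      using assms pos by (simp add: t_def)
    \<comment> \<open>The kernel bound at this \<open>t\<close> gives the admissible constant
      \<open>K = C * t powr (- \<beta>)\<close>.\<close>
    have "ennreal (t powr (- \<alpha>) * (2 * (measure M E - C * t powr (- \<beta>) * (measure M E)\<^sup>2)))
        \<le> perimeter M p \<alpha> E"
      unfolding perimeter_def
      by (rule besov_seminorm_indicator_ge[OF _ _ assms(4,3) t assms(7)[OF t] _ E])
        (use assms in \<open>auto simp: dirichlet_space_def heat_semigroup_def\<close>)
    then show ?thesis
      unfolding isoperimetric_constant_optimal[OF assms(5,8,6) pos, folded t_def] ennreal_mult'[OF nonneg]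
      by (rule mult_left_mono) simp
  qed simp
qed

end
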